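(* There exists a signed graph $\Sigma$ whose underlying graph is planar, $2$-connected, has minimum degree $3$, and is obtained from the wheel $W_5 = K_1\vee C_5$ by adding an edge between two non-adjacent vertices, such that $l(\Sigma) = 3$, $p^-(\Sigma) = 2$ and $p_\triangle(\Sigma) = p(\Sigma) = 3$. In particular $p^-(\Sigma) < \min(l(\Sigma), p_\triangle(\Sigma))$, so the equality $p^-(\Sigma)=\min(l(\Sigma),p(\Sigma))$ does not hold for all signed graphs, not even for all planar ones.
   Context: All graphs are finite, simple and undirected. A signed graph $\Sigma=(G,\sigma)$ is a graph $G$ (the underlying graph) with a signature $\sigma:E(G)\to\{+1,-1\}$. The sign of a cycle is the product of the signs of its edges; $\Sigma$ is balanced if all its cycles are positive. The frustration index $l(\Sigma)$ is the minimum number of edges whose deletion makes $\Sigma$ balanced. $p^-(\Sigma)$ is the maximum number of pairwise edge-disjoint negative cycles in $\Sigma$; $p(\Sigma)$ (respectively $p_\triangle(\Sigma)$) is the maximum number of pairwise edge-disjoint cycles (respectively triangles) of any sign in the underlying graph. $C_5$ is the cycle on $5$ vertices and $\vee$ denotes the join. *)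

theory Defs
  imports "HOL-Analysis.Analysis"
begin

record 'a graph =
  verts :: "'a set"
  edges :: "'a set set"

definition fin_simple_graph :: "'a graph \<Rightarrow> bool" where
  "fin_simple_graph G \<longleftrightarrow>
     finite (verts G) \<and> (\<forall>e\<in>edges G. e \<subseteq> verts G \<and> card e = 2)"

subsection \<open>Joins, complete graphs, cycle graphs, wheels\<close>

definition complete_graph :: "nat \<Rightarrow> nat graph" where
  "complete_graph n =
     \<lparr>verts = {..<n}, edges = {{i, j} | i j. i < n \<and> j < n \<and> i \<noteq> j}\<rparr>"

text \<open>This is the cycle on \<open>n\<close> vertices only for \<open>n \<ge> 3\<close>.\<close>

definition cycle_graph :: "nat \<Rightarrow> nat graph" where
  "cycle_graph n =
     \<lparr>verts = {..<n}, edges = {{i, (i + 1) mod n} | i. i < n}\<rparr>"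

definition graph_join :: "'a graph \<Rightarrow> 'b graph \<Rightarrow> ('a + 'b) graph" where
  "graph_join G H =
     \<lparr>verts = verts G <+> verts H,
      edges = (\<lambda>e. Inl ` e) ` edges G \<union> (\<lambda>e. Inr ` e) ` edges H
            \<union> {{Inl u, Inr v} | u v. u \<in> verts G \<and> v \<in> verts H}\<rparr>"

definition wheel :: "nat \<Rightarrow> (nat + nat) graph" where
  "wheel n = graph_join (complete_graph 1) (cycle_graph n)"

definition add_edge :: "'a graph \<Rightarrow> 'a \<Rightarrow> 'a \<Rightarrow> 'a graph" where
  "add_edge G x y = \<lparr>verts = verts G, edges = insert {x, y} (edges G)\<rparr>"

subsection \<open>Degree, connectivity, planarity\<close>

definition degree :: "'a graph \<Rightarrow> 'a \<Rightarrow> nat" where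
  "degree G v = card {e \<in> edges G. v \<in> e}"

definition min_degree :: "'a graph \<Rightarrow> nat" where
  "min_degree G = Min (degree G ` verts G)"

definition graph_connected :: "'a graph \<Rightarrow> bool" where
  "graph_connected G \<longleftrightarrow>
     verts G \<noteq> {} \<and>
     (\<forall>u\<in>verts G. \<forall>v\<in>verts G. (u, v) \<in> {(x, y). {x, y} \<in> edges G}\<^sup>*)"

definition delete_verts :: "'a graph \<Rightarrow> 'a set \<Rightarrow> 'a graph" where
  "delete_verts G X =
     \<lparr>verts = verts G - X, edges = {e \<in> edges G. e \<inter> X = {}}\<rparr>"

definition k_connected :: "nat \<Rightarrow> 'a graph \<Rightarrow> bool" where
  "k_connected k G \<longleftrightarrow>
     card (verts G) > k \<and>
     (\<forall>X. X \<subseteq> verts G \<and> card X < k \<longrightarrow> graph_connected (delete_verts G X))"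

text \<open>
  A drawing in the plane \<open>\<complex>\<close>: vertices are distinct points, every edge is a simple arc
  between its two ends, an arc passes through no vertex other than its ends, and two
  different arcs meet at most in a common end.
\<close>

definition plane_drawing ::
    "'a graph \<Rightarrow> ('a \<Rightarrow> complex) \<Rightarrow> ('a set \<Rightarrow> real \<Rightarrow> complex) \<Rightarrow> bool" where
  "plane_drawing G p \<gamma> \<longleftrightarrow>
     inj_on p (verts G) \<and>
     (\<forall>e\<in>edges G. arc (\<gamma> e) \<and> {pathstart (\<gamma> e), pathfinish (\<gamma> e)} = p ` e) \<and>
     (\<forall>e\<in>edges G. path_image (\<gamma> e) \<inter> p ` verts G = p ` e) \<and>
     (\<forall>e\<in>edges G. \<forall>f\<in>edges G. e \<noteq> f \<longrightarrow>
        path_image (\<gamma> e) \<inter> path_image (\<gamma> f) \<subseteq> p ` (e \<inter> f))"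

definition planar :: "'a graph \<Rightarrow> bool" where
  "planar G \<longleftrightarrow> (\<exists>p \<gamma>. plane_drawing G p \<gamma>)"

subsection \<open>Cycles and packings\<close>

text \<open>A cycle of a simple graph is identified with its set of edges.\<close>

definition is_cycle :: "'a graph \<Rightarrow> 'a set set \<Rightarrow> bool" where
  "is_cycle G C \<longleftrightarrow>
     C \<subseteq> edges G \<and>
     (\<exists>vs. length vs \<ge> 3 \<and> distinct vs \<and> set vs \<subseteq> verts G \<and>
        C = {{vs ! i, vs ! ((i + 1) mod length vs)} | i. i < length vs})"

definition is_triangle :: "'a graph \<Rightarrow> 'a set set \<Rightarrow> bool" where
  "is_triangle G C \<longleftrightarrow> is_cycle G C \<and> card C = 3"

text \<open>The maximum number of pairwise disjoint edge sets satisfying \<open>Q\<close>.\<close>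

definition packing_number :: "('a set set \<Rightarrow> bool) \<Rightarrow> nat" where
  "packing_number Q = Max {card P | P. (\<forall>C\<in>P. Q C) \<and> disjoint P}"

subsection \<open>Signed graphs\<close>

text \<open>Only the values of the signature on edges of the underlying graph are relevant.\<close>

record 'a signed_graph =
  underlying :: "'a graph"
  signature :: "'a set \<Rightarrow> int"

definition wf_signed_graph :: "'a signed_graph \<Rightarrow> bool" where
  "wf_signed_graph \<Sigma> \<longleftrightarrow>
     fin_simple_graph (underlying \<Sigma>) \<and>
     (\<forall>e\<in>edges (underlying \<Sigma>). signature \<Sigma> e \<in> {1, -1})"

definition cycle_sign :: "'a signed_graph \<Rightarrow> 'a set set \<Rightarrow> int" where
  "cycle_sign \<Sigma> C = (\<Prod>e\<in>C. signature \<Sigma> e)"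

definition is_negative_cycle :: "'a signed_graph \<Rightarrow> 'a set set \<Rightarrow> bool" where
  "is_negative_cycle \<Sigma> C \<longleftrightarrow> is_cycle (underlying \<Sigma>) C \<and> cycle_sign \<Sigma> C = -1"

definition balanced :: "'a signed_graph \<Rightarrow> bool" where
  "balanced \<Sigma> \<longleftrightarrow> (\<forall>C. is_cycle (underlying \<Sigma>) C \<longrightarrow> cycle_sign \<Sigma> C = 1)"

definition delete_edges :: "'a signed_graph \<Rightarrow> 'a set set \<Rightarrow> 'a signed_graph" where
  "delete_edges \<Sigma> F =
     \<lparr>underlying = \<lparr>verts = verts (underlying \<Sigma>), edges = edges (underlying \<Sigma>) - F\<rparr>,
      signature = signature \<Sigma>\<rparr>"

definition frustration_index :: "'a signed_graph \<Rightarrow> nat" where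
  "frustration_index \<Sigma> =
     Min {card F | F. F \<subseteq> edges (underlying \<Sigma>) \<and> balanced (delete_edges \<Sigma> F)}"

definition neg_cycle_packing :: "'a signed_graph \<Rightarrow> nat" where
  "neg_cycle_packing \<Sigma> = packing_number (is_negative_cycle \<Sigma>)"

definition cycle_packing :: "'a signed_graph \<Rightarrow> nat" where
  "cycle_packing \<Sigma> = packing_number (is_cycle (underlying \<Sigma>))"

definition triangle_packing :: "'a signed_graph \<Rightarrow> nat" where
  "triangle_packing \<Sigma> = packing_number (is_triangle (underlying \<Sigma>))"

end

theory Submission
  imports Defs
begin

text \<open>
  Draw the chord between rim vertices 0 and 2 around rim vertex 1, and make exactly the edges from
  the hub to 1 and 3 and the rim edge between 4 and 0 negative. Then the only positive one of the
  seven faces is the triangle on 0, 1, 2. The remaining six faces are negative cycles, and each edge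
  lies on at most two of them, so the frustration index is at least 3; deleting the negative edges
  shows equality. A packing of three cycles exists, namely the triangles on 0, 1, 2, on the hub, 2, 3
  and on the hub, 4, 0, but a parity argument at the odd-degree vertices excludes three disjoint
  negative cycles.
\<close>

subsection \<open>Cycles and packings\<close>

lemma Suc_mod_less: "(i::nat) < n \<Longrightarrow> (i + 1) mod n = (if i + 1 = n then 0 else i + 1)"
  by auto

text \<open>If two different positions gave the same edge, each would be the cyclic successor of the
  other, so the length would divide 2. Injectivity turns counts of edges of a cycle into counts of
  positions.\<close>

lemma cycle_edge_inj:
  assumes d: "distinct vs" and n: "length vs \<ge> 3"
  shows "inj_on (\<lambda>i. {vs ! i, vs ! ((i + 1) mod length vs)}) {..<length vs}"
proof (rule inj_onI)
  fix i j assume ij: "i \<in> {..<length vs}" "j \<in> {..<length vs}"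
    and eq: "{vs ! i, vs ! ((i + 1) mod length vs)} = {vs ! j, vs ! ((j + 1) mod length vs)}"
  define i' j' where "i' = (i + 1) mod length vs" and "j' = (j + 1) mod length vs"
  have lt: "i < length vs" "j < length vs" using ij by auto
  then have i': "i' = (if i + 1 = length vs then 0 else i + 1)"
    and j': "j' = (if j + 1 = length vs then 0 else j + 1)"
    unfolding i'_def j'_def by (simp_all only: Suc_mod_less)
  have lt': "i' < length vs" "j' < length vs" unfolding i' j' using lt by auto
  have "vs ! i = vs ! j \<or> vs ! i = vs ! j' \<and> vs ! i' = vs ! j"
    using eq unfolding i'_def[symmetric] j'_def[symmetric] doubleton_eq_iff by blast
  then have "i = j \<or> i = j' \<and> i' = j"
    using nth_eq_iff_index_eq[OF d] lt lt' by blast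
  then show "i = j" using i' j' n by (auto split: if_splits)
qed

lemma bij_betw_Suc_mod:
  fixes n :: nat
  assumes "n > 0"
  shows "bij_betw (\<lambda>i. (i + 1) mod n) {..<n} {..<n}"
proof -
  have "inj_on (\<lambda>i. (i + 1) mod n) {..<n}"
  proof (rule inj_onI)
    fix x y assume "x \<in> {..<n}" "y \<in> {..<n}" "(x + 1) mod n = (y + 1) mod n"
    then show "x = y" using Suc_mod_less[of x n] Suc_mod_less[of y n] by (simp split: if_splits)
  qed
  moreover have "(\<lambda>i. (i + 1) mod n) ` {..<n} \<subseteq> {..<n}" using assms by auto
  ultimately show ?thesis
    by (simp add: bij_betw_def endo_inj_surj)
qed

lemma is_cycleE:
  assumes "is_cycle G C"
  obtains vs where "length vs \<ge> 3" "distinct vs" "C \<subseteq> edges G"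
    "C = (\<lambda>i. {vs ! i, vs ! ((i + 1) mod length vs)}) ` {..<length vs}"
  using assms unfolding is_cycle_def setcompr_eq_image lessThan_def by blast

lemma is_cycle_card_ge_3:
  assumes "is_cycle G C"
  shows "card C \<ge> 3"
proof -
  obtain vs where vs: "length vs \<ge> 3" "distinct vs"
    and C: "C = (\<lambda>i. {vs ! i, vs ! ((i + 1) mod length vs)}) ` {..<length vs}"
    using assms by (rule is_cycleE)
  show ?thesis unfolding C card_image[OF cycle_edge_inj[OF vs(2,1)]] using vs(1) by simp
qed

text \<open>An infinite set has \<open>card\<close> 0, which contradicts the lower bound 3.\<close>

lemma is_cycle_finite: "is_cycle G C \<Longrightarrow> finite C"
  using is_cycle_card_ge_3 card.infinite by fastforce

text \<open>Summing over positions, \<open>v\<close> is counted once as the start and once as the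
  end of an edge; the cyclic shift shows that both counts agree, so the total is twice one of
  them.\<close>

lemma is_cycle_even_degree:
  assumes "is_cycle G C"
  shows "even (card {e \<in> C. v \<in> e})"
proof -
  obtain vs where vs: "length vs \<ge> 3" "distinct vs"
    and C: "C = (\<lambda>i. {vs ! i, vs ! ((i + 1) mod length vs)}) ` {..<length vs}"
    using assms by (rule is_cycleE)
  let ?n = "length vs"
  define d where "d w = (if w = v then 1 else 0 :: nat)" for w
  have "card {e \<in> C. v \<in> e} = (\<Sum>e\<in>C. if v \<in> e then 1 else 0)"
    using is_cycle_finite[OF assms] by (simp add: sum.If_cases Int_def)
  also have "\<dots> = (\<Sum>i<?n. if v \<in> {vs ! i, vs ! ((i + 1) mod ?n)} then 1 else 0)"
    unfolding C by (subst sum.reindex[OF cycle_edge_inj[OF vs(2,1)]]) simp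
  also have "\<dots> = (\<Sum>i<?n. d (vs ! i) + d (vs ! ((i + 1) mod ?n)))"
  proof (rule sum.cong[OF refl])
    fix i assume i: "i \<in> {..<?n}"
    \<comment> \<open>The ends of an edge differ, so at most one of the two summands is 1 and their
      sum is the indicator of incidence.\<close>
    then have "i \<noteq> (i + 1) mod ?n" using vs(1) by (auto simp: mod_Suc)
    moreover have "(i + 1) mod ?n < ?n" using vs(1) by (intro mod_less_divisor) linarith
    ultimately have "vs ! i \<noteq> vs ! ((i + 1) mod ?n)"
      using i vs(2) by (metis lessThan_iff nth_eq_iff_index_eq)
    then show "(if v \<in> {vs ! i, vs ! ((i + 1) mod ?n)} then 1 else 0)
        = d (vs ! i) + d (vs ! ((i + 1) mod ?n))"
      by (auto simp: d_def)
  qed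
  also have "\<dots> = (\<Sum>i<?n. d (vs ! i)) + (\<Sum>i<?n. d (vs ! ((i + 1) mod ?n)))"
    by (rule sum.distrib)
  also have "(\<Sum>i<?n. d (vs ! ((i + 1) mod ?n))) = (\<Sum>i<?n. d (vs ! i))"
    by (rule sum.reindex_bij_betw[OF bij_betw_Suc_mod]) (use vs(1) in linarith)
  finally show ?thesis by simp
qed

lemma is_cycle_triangle:
  assumes "distinct [a, b, c]" "{a, b, c} \<subseteq> verts G"
    "{a, b} \<in> edges G" "{b, c} \<in> edges G" "{c, a} \<in> edges G"
  shows "is_cycle G {{a, b}, {b, c}, {c, a}}"
  unfolding is_cycle_def
proof (intro conjI exI[of _ "[a, b, c]"])
  have "{{[a, b, c] ! i, [a, b, c] ! ((i + 1) mod length [a, b, c])} |i. i < length [a, b, c]}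
      = (\<lambda>i. {[a, b, c] ! i, [a, b, c] ! ((i + 1) mod length [a, b, c])}) ` {0, 1, 2}"
    unfolding setcompr_eq_image by (rule arg_cong[where f = "image _"]) auto
  also have "\<dots> = {{a, b}, {b, c}, {c, a}}" by simp
  finally show "{{a, b}, {b, c}, {c, a}}
    = {{[a, b, c] ! i, [a, b, c] ! ((i + 1) mod length [a, b, c])} |i. i < length [a, b, c]}"
    by (rule sym)
qed (use assms in simp_all)

lemma is_cycle_quadrilateral:
  assumes "distinct [a, b, c, d]" "{a, b, c, d} \<subseteq> verts G"
    "{a, b} \<in> edges G" "{b, c} \<in> edges G" "{c, d} \<in> edges G" "{d, a} \<in> edges G"
  shows "is_cycle G {{a, b}, {b, c}, {c, d}, {d, a}}"
  unfolding is_cycle_def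
proof (intro conjI exI[of _ "[a, b, c, d]"])
  have "{{[a, b, c, d] ! i, [a, b, c, d] ! ((i + 1) mod length [a, b, c, d])} |i.
        i < length [a, b, c, d]}
      = (\<lambda>i. {[a, b, c, d] ! i, [a, b, c, d] ! ((i + 1) mod length [a, b, c, d])}) ` {0, 1, 2, 3}"
    unfolding setcompr_eq_image by (rule arg_cong[where f = "image _"]) auto
  also have "\<dots> = {{a, b}, {b, c}, {c, d}, {d, a}}" by simp
  finally show "{{a, b}, {b, c}, {c, d}, {d, a}}
    = {{[a, b, c, d] ! i, [a, b, c, d] ! ((i + 1) mod length [a, b, c, d])} |i.
        i < length [a, b, c, d]}"
    by (rule sym)
qed (use assms in simp_all)

section \<open>Bounds for packings\<close>

lemma packing_number_eqI:
  assumes le: "\<And>P. \<forall>C\<in>P. Q C \<Longrightarrow> disjoint P \<Longrightarrow> card P \<le> k"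
    and P: "\<forall>C\<in>P. Q C" "disjoint P" "card P = k"
  shows "packing_number Q = k"
  unfolding packing_number_def
proof (rule Max_eqI)
  show "n \<le> k" if "n \<in> {card P | P. (\<forall>C\<in>P. Q C) \<and> disjoint P}" for n
    using that le by blast
  \<comment> \<open>The upper bound also supplies the finiteness without which \<open>Max\<close> is
    unspecified.\<close>
  then show "finite {card P | P. (\<forall>C\<in>P. Q C) \<and> disjoint P}"
    by (meson finite_nat_set_iff_bounded_le)
  show "k \<in> {card P | P. (\<forall>C\<in>P. Q C) \<and> disjoint P}"
    using P by blast
qed

lemma disjoint_pair:
  assumes "A \<inter> B = {}" "A \<noteq> {}"
  shows "disjoint {A, B}" "card {A, B} = 2"
proof -
  show "disjoint {A, B}" using assms by (auto simp: disjoint_def)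
  have "A \<noteq> B" using assms by blast
  then show "card {A, B} = 2" by simp
qed

lemma disjoint_triple:
  assumes "A \<inter> B = {}" "A \<inter> C = {}" "B \<inter> C = {}" "A \<noteq> {}" "B \<noteq> {}"
  shows "disjoint {A, B, C}" "card {A, B, C} = 3"
proof -
  show "disjoint {A, B, C}" using assms by (auto simp: disjoint_def)
  have "A \<noteq> B" "A \<noteq> C" "B \<noteq> C" using assms by blast+
  then show "card {A, B, C} = 3" by simp
qed

lemma card_cycle_packing_le:
  assumes "\<forall>C\<in>P. is_cycle G C" "disjoint P"
  shows "3 * card P \<le> card (\<Union> P)"
proof -
  have "3 * card P \<le> (\<Sum>C\<in>P. card C)"
    using sum_bounded_below[of P 3 card] assms(1) is_cycle_card_ge_3 by (auto simp: mult.commute)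
  also have "\<dots> = card (\<Union> P)"
    using assms by (intro card_Union_disjoint[symmetric]) (auto intro: is_cycle_finite)
  finally show ?thesis .
qed

text \<open>Degrees add over edge-disjoint cycles. Hence a cycle packing misses an edge at every
  vertex of odd degree, which is the parity obstruction used below.\<close>

lemma cycle_packing_even_degree:
  assumes "\<forall>C\<in>P. is_cycle G C" "disjoint P" "finite P"
  shows "even (card {e \<in> \<Union> P. v \<in> e})"
proof -
  have "{e \<in> \<Union> P. v \<in> e} = (\<Union>C\<in>P. {e \<in> C. v \<in> e})" by auto
  moreover have "card (\<Union>C\<in>P. {e \<in> C. v \<in> e}) = (\<Sum>C\<in>P. card {e \<in> C. v \<in> e})"
    using assms by (intro card_UN_disjoint) (auto simp: pairwise_def disjnt_def intro: finite_subset[OF _ is_cycle_finite])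
  ultimately show ?thesis
    using assms(1) is_cycle_even_degree by (fastforce intro: dvd_sum)
qed

section \<open>Lower bounds for the frustration index\<close>

lemma frustration_index_eqI:
  assumes le: "\<And>F. F \<subseteq> edges (underlying \<Sigma>) \<Longrightarrow> balanced (delete_edges \<Sigma> F) \<Longrightarrow> k \<le> card F"
    and F: "F \<subseteq> edges (underlying \<Sigma>)" "balanced (delete_edges \<Sigma> F)" "card F = k"
    and fin: "finite (edges (underlying \<Sigma>))"
  shows "frustration_index \<Sigma> = k"
  unfolding frustration_index_def
proof (rule Min_eqI)
  have "{card F | F. F \<subseteq> edges (underlying \<Sigma>) \<and> balanced (delete_edges \<Sigma> F)}
      \<subseteq> card ` Pow (edges (underlying \<Sigma>))" by blast
  then show "finite {card F | F. F \<subseteq> edges (underlying \<Sigma>) \<and> balanced (delete_edges \<Sigma> F)}"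
    by (rule finite_subset) (simp add: fin)
  show "k \<le> n" if "n \<in> {card F | F. F \<subseteq> edges (underlying \<Sigma>) \<and> balanced (delete_edges \<Sigma> F)}" for n
    using that le by blast
  show "k \<in> {card F | F. F \<subseteq> edges (underlying \<Sigma>) \<and> balanced (delete_edges \<Sigma> F)}"
    using F by blast
qed

text \<open>A negative cycle that avoids \<open>F\<close> would survive the deletion with its sign
  unchanged.\<close>

lemma balanced_delete_edges_meets_negative_cycle:
  assumes "balanced (delete_edges \<Sigma> F)" "is_negative_cycle \<Sigma> C"
  shows "C \<inter> F \<noteq> {}"
proof
  assume "C \<inter> F = {}"
  then have "is_cycle (underlying (delete_edges \<Sigma> F)) C"
    using assms(2) by (auto simp: is_negative_cycle_def is_cycle_def delete_edges_def)
  then have "cycle_sign (delete_edges \<Sigma> F) C = 1" using assms(1) by (auto simp: balanced_def)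
  then show False using assms(2)
    by (simp add: is_negative_cycle_def cycle_sign_def delete_edges_def)
qed

text \<open>Double counting of the incidences between \<open>F\<close> and the negative cycles \<open>C i\<close>.\<close>

lemma frustration_double_count:
  assumes "balanced (delete_edges \<Sigma> F)" "finite F" "finite I"
    and "\<forall>i\<in>I. is_negative_cycle \<Sigma> (C i)"
    and "\<forall>e\<in>F. card {i \<in> I. e \<in> C i} \<le> k"
  shows "card I \<le> k * card F"
proof -
  have "1 \<le> card {e \<in> F. e \<in> C i}" if "i \<in> I" for i
    using balanced_delete_edges_meets_negative_cycle[OF assms(1), of "C i"] assms(2,4) that
    by (auto simp: Suc_le_eq card_gt_0_iff)
  then have "card I \<le> (\<Sum>i\<in>I. card {e \<in> F. e \<in> C i})"
    using sum_mono[of I "\<lambda>_. 1" "\<lambda>i. card {e \<in> F. e \<in> C i}"] by simp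
  also have "\<dots> = (\<Sum>e\<in>F. card {i \<in> I. e \<in> C i})"
    using sum.swap_restrict[OF assms(3,2), of "\<lambda>_ _. 1::nat" "\<lambda>i e. e \<in> C i"] by simp
  also have "\<dots> \<le> k * card F"
    using sum_bounded_above[of F _ k] assms(5) by (simp add: mult.commute)
  finally show ?thesis .
qed

subsection \<open>Connectivity and planarity\<close>

text \<open>Adjacency is symmetric, so any two vertices are joined by a walk through the root
  \<open>r\<close>.\<close>

lemma graph_connectedI:
  assumes "r \<in> verts G"
    and "\<And>v. v \<in> verts G \<Longrightarrow> (r, v) \<in> {(x, y). {x, y} \<in> edges G}\<^sup>*"
  shows "graph_connected G"
proof -
  have "sym {(x, y). {x, y} \<in> edges G}" by (auto simp: sym_def insert_commute)
  then have "sym ({(x, y). {x, y} \<in> edges G}\<^sup>*)" by (rule sym_rtrancl)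
  then show ?thesis unfolding graph_connected_def
    using assms by (metis (no_types, lifting) empty_iff rtrancl_trans symE)
qed

lemma mem_edges_delete_verts:
  "{a, b} \<in> edges (delete_verts G X) \<longleftrightarrow> {a, b} \<in> edges G \<and> a \<notin> X \<and> b \<notin> X"
  by (simp add: delete_verts_def)

text \<open>Drawing every edge as a segment reduces planarity to statements about convex hulls of
  pairs of points, with no paths left in the hypotheses.\<close>

lemma planar_straight_line:
  fixes p :: "'a \<Rightarrow> complex"
  assumes G: "\<forall>e\<in>edges G. e \<subseteq> verts G \<and> card e = 2"
    and inj: "inj_on p (verts G)"
    and verts: "\<And>e v. e \<in> edges G \<Longrightarrow> v \<in> verts G \<Longrightarrow> p v \<in> convex hull (p ` e) \<Longrightarrow> v \<in> e"
    and cross: "\<And>e f. e \<in> edges G \<Longrightarrow> f \<in> edges G \<Longrightarrow> e \<noteq> f \<Longrightarrow>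
      convex hull (p ` e) \<inter> convex hull (p ` f) \<subseteq> p ` (e \<inter> f)"
  shows "planar G"
proof -
  \<comment> \<open>An edge is an unordered pair; the choice of a direction is hidden in this
    existence statement, and afterwards only the image matters.\<close>
  have "\<exists>g. arc g \<and> {pathstart g, pathfinish g} = p ` e \<and> path_image g = convex hull (p ` e)"
    if e: "e \<in> edges G" for e
  proof -
    have "card e = 2" using G e by blast
    then obtain a b where ab: "e = {a, b}" "a \<noteq> b" unfolding card_2_iff by blast
    then have "a \<in> verts G" "b \<in> verts G" using G e by blast+
    then have "p a \<noteq> p b" using ab(2) inj by (auto dest: inj_onD)
    with ab show ?thesis
      by (intro exI[of _ "linepath (p a) (p b)"]) (simp add: arc_linepath segment_convex_hull)
  qed
  then obtain \<gamma> where \<gamma>: "\<And>e. e \<in> edges G \<Longrightarrow> arc (\<gamma> e) \<and>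
      {pathstart (\<gamma> e), pathfinish (\<gamma> e)} = p ` e \<and> path_image (\<gamma> e) = convex hull (p ` e)"
    by metis
  have "path_image (\<gamma> e) \<inter> p ` verts G = p ` e" if "e \<in> edges G" for e
  proof -
    have "p ` e \<subseteq> convex hull (p ` e)" by (rule hull_subset)
    moreover have "e \<subseteq> verts G" using G that by blast
    moreover have "convex hull (p ` e) \<inter> p ` verts G \<subseteq> p ` e" using verts[OF that] by blast
    ultimately show ?thesis using \<gamma>[OF that] by blast
  qed
  then have "plane_drawing G p \<gamma>"
    unfolding plane_drawing_def using inj \<gamma> cross by simp
  then show ?thesis unfolding planar_def by blast
qed

subsection \<open>The wheel with a chord\<close>

abbreviation (input) hub :: "nat + nat" where "hub \<equiv> Inl 0"

abbreviation (input) rim :: "nat \<Rightarrow> nat + nat" where "rim i \<equiv> Inr i"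

text \<open>The hub is adjacent to every rim vertex, so a chord must join two rim vertices at
  distance 2; by rotation all choices give isomorphic graphs.\<close>

definition chorded_wheel :: "(nat + nat) graph" where
  "chorded_wheel = add_edge (wheel 5) (rim 0) (rim 2)"

lemma lessThan_5: "{..<5::nat} = {0, 1, 2, 3, 4}"
  by auto

text \<open>As a rewrite rule this filters an explicitly listed set one element at a time, here for
  incident edges and for faces at an edge.\<close>

lemma Collect_mem_insert:
  "{x \<in> insert a A. P x} = (if P a then insert a else id) {x \<in> A. P x}"
  by auto

lemma verts_wheel_5: "verts (wheel 5) = {hub, rim 0, rim 1, rim 2, rim 3, rim 4}"
proof -
  have "{..<1::nat} = {0}" by auto
  then show ?thesis
    unfolding wheel_def graph_join_def complete_graph_def cycle_graph_def graph.simps lessThan_5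
    by (simp add: Plus_def insert_commute)
qed

lemma edges_wheel_5: "edges (wheel 5) =
  {{rim 0, rim 1}, {rim 1, rim 2}, {rim 2, rim 3}, {rim 3, rim 4}, {rim 4, rim 0},
   {hub, rim 0}, {hub, rim 1}, {hub, rim 2}, {hub, rim 3}, {hub, rim 4}}"
proof -
  have "edges (cycle_graph 5) = (\<lambda>i. {i, (i + 1) mod 5}) ` {0, 1, 2, 3, 4}"
    unfolding cycle_graph_def graph.simps setcompr_eq_image lessThan_5[symmetric] lessThan_def ..
  also have "\<dots> = {{0, 1}, {1, 2}, {2, 3}, {3, 4}, {4, 0}}"
    by (simp add: numeral_2_eq_2)
  finally have cycle: "edges (cycle_graph 5) = {{0, 1}, {1, 2}, {2, 3}, {3, 4}, {4, 0}}" .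
  have "{{Inl u, Inr v} | u v. u \<in> verts (complete_graph 1) \<and> v \<in> verts (cycle_graph 5)}
      = (\<lambda>v. {hub, rim v}) ` {..<5}"
    by (auto simp: complete_graph_def cycle_graph_def)
  then have spokes:
    "{{Inl u, Inr v} | u v. u \<in> verts (complete_graph 1) \<and> v \<in> verts (cycle_graph 5)}
      = {{hub, rim 0}, {hub, rim 1}, {hub, rim 2}, {hub, rim 3}, {hub, rim 4}}"
    unfolding lessThan_5 by simp
  have K1: "edges (complete_graph 1) = {}"
    by (auto simp: complete_graph_def)
  show ?thesis
    unfolding wheel_def graph_join_def graph.simps spokes cycle K1
    by (simp only: image_insert image_empty Un_insert_left Un_empty_left)
qed

lemma verts_chorded_wheel [simp]:
  "verts chorded_wheel = {hub, rim 0, rim 1, rim 2, rim 3, rim 4}"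
  by (simp add: chorded_wheel_def add_edge_def verts_wheel_5)

lemma edges_chorded_wheel: "edges chorded_wheel =
  {{rim 0, rim 2},
   {rim 0, rim 1}, {rim 1, rim 2}, {rim 2, rim 3}, {rim 3, rim 4}, {rim 4, rim 0},
   {hub, rim 0}, {hub, rim 1}, {hub, rim 2}, {hub, rim 3}, {hub, rim 4}}"
  unfolding chorded_wheel_def add_edge_def graph.simps edges_wheel_5 ..

lemma finite_edges_chorded_wheel: "finite (edges chorded_wheel)"
  by (simp add: edges_chorded_wheel)

lemma card_edges_chorded_wheel: "card (edges chorded_wheel) = 11"
  by (simp add: edges_chorded_wheel doubleton_eq_iff)

lemma simple_chorded_wheel: "\<forall>e\<in>edges chorded_wheel. e \<subseteq> verts chorded_wheel \<and> card e = 2"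
  by (simp add: edges_chorded_wheel)

lemma incident_chorded_wheel:
  "{e \<in> edges chorded_wheel. hub \<in> e} =
    {{hub, rim 0}, {hub, rim 1}, {hub, rim 2}, {hub, rim 3}, {hub, rim 4}}"
  "{e \<in> edges chorded_wheel. rim 0 \<in> e} =
    {{rim 0, rim 2}, {rim 0, rim 1}, {rim 4, rim 0}, {hub, rim 0}}"
  "{e \<in> edges chorded_wheel. rim 1 \<in> e} = {{rim 0, rim 1}, {rim 1, rim 2}, {hub, rim 1}}"
  "{e \<in> edges chorded_wheel. rim 2 \<in> e} =
    {{rim 0, rim 2}, {rim 1, rim 2}, {rim 2, rim 3}, {hub, rim 2}}"
  "{e \<in> edges chorded_wheel. rim 3 \<in> e} = {{rim 2, rim 3}, {rim 3, rim 4}, {hub, rim 3}}"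
  "{e \<in> edges chorded_wheel. rim 4 \<in> e} = {{rim 3, rim 4}, {rim 4, rim 0}, {hub, rim 4}}"
  unfolding edges_chorded_wheel Collect_mem_insert by simp_all

lemma degree_chorded_wheel:
  "degree chorded_wheel hub = 5" "degree chorded_wheel (rim 0) = 4"
  "degree chorded_wheel (rim 1) = 3" "degree chorded_wheel (rim 2) = 4"
  "degree chorded_wheel (rim 3) = 3" "degree chorded_wheel (rim 4) = 3"
  unfolding degree_def incident_chorded_wheel by (simp_all add: doubleton_eq_iff)

lemma min_degree_chorded_wheel: "min_degree chorded_wheel = 3"
  unfolding min_degree_def verts_chorded_wheel image_insert image_empty degree_chorded_wheel by simp

text \<open>If the hub survives, it is adjacent to all other remaining vertices. Otherwise only the
  hub is removed, and \<open>rim 0\<close> reaches 1, 2 and 4 directly and 3 through 2.\<close>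

lemma two_connected_chorded_wheel: "k_connected 2 chorded_wheel"
  unfolding k_connected_def
proof (intro conjI allI impI)
  show "2 < card (verts chorded_wheel)" by simp
next
  fix X assume X: "X \<subseteq> verts chorded_wheel \<and> card X < 2"
  then have fin: "finite X" by (intro finite_subset[of X "verts chorded_wheel"]) simp_all
  let ?D = "delete_verts chorded_wheel X"
  let ?R = "{(x, y). {x, y} \<in> edges ?D}"
  show "graph_connected ?D"
  proof (cases "hub \<in> X")
    case False
    show ?thesis
    proof (rule graph_connectedI[of hub])
      show "hub \<in> verts ?D" using False by (simp add: delete_verts_def)
      fix v assume "v \<in> verts ?D"
      then have v: "v \<in> verts chorded_wheel" "v \<notin> X" by (simp_all add: delete_verts_def)
      have "v = hub \<or> {hub, v} \<in> edges chorded_wheel"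
        using v(1) unfolding verts_chorded_wheel by (elim insertE) (simp_all add: edges_chorded_wheel)
      then have "v = hub \<or> (hub, v) \<in> ?R"
        using v(2) False by (simp add: mem_edges_delete_verts)
      then show "(hub, v) \<in> ?R\<^sup>*" by blast
    qed
  next
    case True
    then have "X = {hub}"
      using X card_le_Suc0_iff_eq[OF fin] by auto
    then have R: "(rim 0, rim 1) \<in> ?R" "(rim 0, rim 2) \<in> ?R" "(rim 0, rim 4) \<in> ?R"
      "(rim 2, rim 3) \<in> ?R"
      by (simp_all add: mem_edges_delete_verts) (simp_all add: edges_chorded_wheel insert_commute)
    show ?thesis
    proof (rule graph_connectedI[of "rim 0"])
      show "rim 0 \<in> verts ?D" using \<open>X = {hub}\<close> by (simp add: delete_verts_def)
      fix v assume "v \<in> verts ?D"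
      then have "v \<in> {rim 0, rim 1, rim 2, rim 3, rim 4}"
        using \<open>X = {hub}\<close> by (simp add: delete_verts_def)
      then show "(rim 0, v) \<in> ?R\<^sup>*"
        using R by (elim insertE emptyE; hypsubst; blast intro: rtrancl_into_rtrancl)
    qed
  qed
qed

text \<open>
  The rim vertices 0, 2, 3, 4 form a square around the hub, and rim vertex 1 lies inside the
  triangle spanned by the hub and the chord.
\<close>

fun position :: "nat + nat \<Rightarrow> complex" where
  "position (Inl _) = 0"
| "position (Inr i) = (if i = 0 then Complex (-2) 2 else if i = 1 then Complex 0 1
    else if i = 2 then Complex 2 2 else if i = 3 then Complex 2 (-2) else Complex (-2) (-2))"

lemma mem_convex_hull_pair:
  assumes "z \<in> convex hull {a, b :: complex}"
  obtains t where "0 \<le> t" "t \<le> 1" "Re z = Re a + t * (Re b - Re a)" "Im z = Im a + t * (Im b - Im a)"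
proof -
  obtain u where "z = (1 - u) *\<^sub>R a + u *\<^sub>R b" "0 \<le> u" "u \<le> 1"
    using assms unfolding segment_convex_hull[symmetric] in_segment by blast
  then show thesis by (intro that[of u]) (simp_all, simp_all add: algebra_simps)
qed

text \<open>Each segment is given by the equation of its line and the range of one coordinate. With
  the segment parameter eliminated, incidences and crossings become problems of linear
  arithmetic.\<close>

lemma chorded_wheel_segments:
  assumes "e \<in> edges chorded_wheel" "z \<in> convex hull (position ` e)"
  shows "e = {hub, rim 0} \<and> Im z = - Re z \<and> -2 \<le> Re z \<and> Re z \<le> 0
    \<or> e = {hub, rim 1} \<and> Re z = 0 \<and> 0 \<le> Im z \<and> Im z \<le> 1
    \<or> e = {hub, rim 2} \<and> Im z = Re z \<and> 0 \<le> Re z \<and> Re z \<le> 2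
    \<or> e = {hub, rim 3} \<and> Im z = - Re z \<and> 0 \<le> Re z \<and> Re z \<le> 2
    \<or> e = {hub, rim 4} \<and> Im z = Re z \<and> -2 \<le> Re z \<and> Re z \<le> 0
    \<or> e = {rim 0, rim 1} \<and> 2 * Im z = 2 - Re z \<and> -2 \<le> Re z \<and> Re z \<le> 0
    \<or> e = {rim 1, rim 2} \<and> 2 * Im z = 2 + Re z \<and> 0 \<le> Re z \<and> Re z \<le> 2
    \<or> e = {rim 2, rim 3} \<and> Re z = 2 \<and> -2 \<le> Im z \<and> Im z \<le> 2
    \<or> e = {rim 3, rim 4} \<and> Im z = -2 \<and> -2 \<le> Re z \<and> Re z \<le> 2
    \<or> e = {rim 4, rim 0} \<and> Re z = -2 \<and> -2 \<le> Im z \<and> Im z \<le> 2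
    \<or> e = {rim 0, rim 2} \<and> Im z = 2 \<and> -2 \<le> Re z \<and> Re z \<le> 2"
  using assms(1)[unfolded edges_chorded_wheel] assms(2)
  by (elim insertE emptyE; hypsubst; simp only: image_insert image_empty;
      elim mem_convex_hull_pair; simp add: doubleton_eq_iff)

lemma planar_chorded_wheel: "planar chorded_wheel"
proof (rule planar_straight_line)
  show "\<forall>e\<in>edges chorded_wheel. e \<subseteq> verts chorded_wheel \<and> card e = 2"
    by (rule simple_chorded_wheel)
  show "inj_on position (verts chorded_wheel)"
    by (auto simp: inj_on_def complex_eq_iff)
  show "v \<in> e" if "e \<in> edges chorded_wheel" "v \<in> verts chorded_wheel"
    "position v \<in> convex hull (position ` e)" for e v
    using that(2) chorded_wheel_segments[OF that(1,3)] by (elim disjE; auto)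
  show "convex hull (position ` e) \<inter> convex hull (position ` f) \<subseteq> position ` (e \<inter> f)"
    if ef: "e \<in> edges chorded_wheel" "f \<in> edges chorded_wheel" "e \<noteq> f" for e f
  proof
    fix z assume z: "z \<in> convex hull (position ` e) \<inter> convex hull (position ` f)"
    show "z \<in> position ` (e \<inter> f)"
      \<comment> \<open>Of the 121 pairs of cases, the diagonal ones contradict
        \<open>e \<noteq> f\<close>; in the others the linear constraints are inconsistent or force
        \<open>z\<close> to be the position of the common end.\<close>
      using chorded_wheel_segments[OF ef(1) IntD1[OF z]] chorded_wheel_segments[OF ef(2) IntD2[OF z]]
        ef(3)
      by (elim disjE conjE; hypsubst; simp add: complex_eq_iff; linarith?)
  qed
qed

subsection \<open>The signature\<close>

definition negative_edges :: "(nat + nat) set set" where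
  "negative_edges = {{hub, rim 1}, {hub, rim 3}, {rim 4, rim 0}}"

definition signed_chorded_wheel :: "(nat + nat) signed_graph" where
  "signed_chorded_wheel =
    \<lparr>underlying = chorded_wheel, signature = (\<lambda>e. if e \<in> negative_edges then -1 else 1)\<rparr>"

lemma underlying_signed_chorded_wheel [simp]: "underlying signed_chorded_wheel = chorded_wheel"
  by (simp add: signed_chorded_wheel_def)

lemma signature_signed_chorded_wheel [simp]:
  "signature signed_chorded_wheel e = (if e \<in> negative_edges then -1 else 1)"
  by (simp add: signed_chorded_wheel_def)

text \<open>The three sets are pairwise disjoint, so edges missed at these odd-degree vertices are
  different. The vertex \<open>rim 4\<close> has odd degree too, but positive edges join it to the
  hub and to \<open>rim 3\<close>.\<close>

lemma positive_incident_chorded_wheel: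
  "{e \<in> edges chorded_wheel. hub \<in> e} - negative_edges =
    {{hub, rim 0}, {hub, rim 2}, {hub, rim 4}}"
  "{e \<in> edges chorded_wheel. rim 1 \<in> e} - negative_edges = {{rim 0, rim 1}, {rim 1, rim 2}}"
  "{e \<in> edges chorded_wheel. rim 3 \<in> e} - negative_edges = {{rim 2, rim 3}, {rim 3, rim 4}}"
  unfolding incident_chorded_wheel negative_edges_def
  by (simp_all add: insert_Diff_if doubleton_eq_iff)

text \<open>Without a negative edge the product of signs is 1. Hence disjoint negative cycles use up
  different negative edges.\<close>

lemma negative_cycle_meets_negative_edges:
  assumes "is_negative_cycle signed_chorded_wheel C"
  shows "C \<inter> negative_edges \<noteq> {}"
proof
  assume "C \<inter> negative_edges = {}"
  then have "cycle_sign signed_chorded_wheel C = 1"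
    unfolding cycle_sign_def by (intro prod.neutral) auto
  then show False using assms by (simp add: is_negative_cycle_def)
qed

text \<open>The five triangles at the hub, followed by the boundary of the outer face. Numbering
  them lets the double count run over indices, without comparing faces as sets.\<close>

definition negative_face :: "nat \<Rightarrow> (nat + nat) set set" where
  "negative_face i =
    [{{hub, rim 0}, {rim 0, rim 1}, {rim 1, hub}},
     {{hub, rim 1}, {rim 1, rim 2}, {rim 2, hub}},
     {{hub, rim 2}, {rim 2, rim 3}, {rim 3, hub}},
     {{hub, rim 3}, {rim 3, rim 4}, {rim 4, hub}},
     {{hub, rim 4}, {rim 4, rim 0}, {rim 0, hub}},
     {{rim 0, rim 2}, {rim 2, rim 3}, {rim 3, rim 4}, {rim 4, rim 0}}] ! i"

lemma lessThan_6: "{..<6::nat} = {0, 1, 2, 3, 4, 5}"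
  by auto

text \<open>Each of these faces contains exactly one negative edge, and each negative edge separates
  two of them.\<close>

lemma negative_face_negative:
  assumes "i \<in> {..<6}"
  shows "is_negative_cycle signed_chorded_wheel (negative_face i)"
proof -
  have "is_cycle chorded_wheel (negative_face i)"
    using assms unfolding lessThan_6
    by (elim insertE emptyE; simp add: negative_face_def;
        intro is_cycle_triangle is_cycle_quadrilateral;
        simp add: edges_chorded_wheel insert_commute)
  moreover have "cycle_sign signed_chorded_wheel (negative_face i) = -1"
    using assms unfolding lessThan_6
    by (elim insertE emptyE;
        simp add: negative_face_def cycle_sign_def negative_edges_def doubleton_eq_iff)
  ultimately show ?thesis by (simp add: is_negative_cycle_def)
qed

lemma card_negative_faces_at_edge:
  assumes "e \<in> edges chorded_wheel"
  shows "card {i \<in> {..<6}. e \<in> negative_face i} \<le> 2"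
  using assms unfolding edges_chorded_wheel lessThan_6 Collect_mem_insert negative_face_def
  by (elim insertE emptyE; hypsubst; simp add: doubleton_eq_iff)

lemma frustration_index_signed_chorded_wheel: "frustration_index signed_chorded_wheel = 3"
proof (rule frustration_index_eqI)
  fix F assume F: "F \<subseteq> edges (underlying signed_chorded_wheel)"
    and b: "balanced (delete_edges signed_chorded_wheel F)"
  \<comment> \<open>Six negative faces must be hit, and a deleted edge hits at most two.\<close>
  have "card {..<6::nat} \<le> 2 * card F"
  proof (rule frustration_double_count[OF b])
    show "finite F" using F finite_edges_chorded_wheel finite_subset by auto
    show "\<forall>i\<in>{..<6}. is_negative_cycle signed_chorded_wheel (negative_face i)"
      using negative_face_negative by blast
    show "\<forall>e\<in>F. card {i \<in> {..<6}. e \<in> negative_face i} \<le> 2"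
      using F card_negative_faces_at_edge by auto
  qed simp
  then show "3 \<le> card F" by simp
next
  show "negative_edges \<subseteq> edges (underlying signed_chorded_wheel)"
    by (simp add: negative_edges_def edges_chorded_wheel)
  show "balanced (delete_edges signed_chorded_wheel negative_edges)"
    unfolding balanced_def
  proof (intro allI impI)
    fix C assume "is_cycle (underlying (delete_edges signed_chorded_wheel negative_edges)) C"
    \<comment> \<open>Only positive edges remain, so every sign in the product is 1.\<close>
    then have "C \<subseteq> edges chorded_wheel - negative_edges"
      unfolding is_cycle_def by (simp add: delete_edges_def)
    then have "C \<inter> negative_edges = {}" by blast
    then show "cycle_sign (delete_edges signed_chorded_wheel negative_edges) C = 1"
      unfolding cycle_sign_def delete_edges_def by (intro prod.neutral) auto
  qed
  show "card negative_edges = 3" by (simp add: negative_edges_def doubleton_eq_iff)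
qed (simp add: finite_edges_chorded_wheel)

section \<open>Packing numbers of the signed wheel\<close>

lemma card_cycle_packing_chorded_wheel:
  assumes "\<forall>C\<in>P. is_cycle chorded_wheel C" "disjoint P"
  shows "card P \<le> 3"
proof -
  have "\<Union> P \<subseteq> edges chorded_wheel"
    using assms(1) unfolding is_cycle_def by blast
  \<comment> \<open>Four disjoint cycles would need at least 12 edges.\<close>
  then have "card (\<Union> P) \<le> 11"
    using card_mono[OF finite_edges_chorded_wheel] card_edges_chorded_wheel by metis
  then show ?thesis using card_cycle_packing_le[OF assms] by simp
qed

text \<open>One witness serves both packing numbers of arbitrary sign, since triangles are
  cycles.\<close>

lemma triangle_packing_chorded_wheel:
  obtains P where "\<forall>C\<in>P. is_triangle chorded_wheel C" "disjoint P" "card P = 3"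
proof
  let ?A = "{{rim 0, rim 1}, {rim 1, rim 2}, {rim 2, rim 0}}"
  let ?B = "{{hub, rim 2}, {rim 2, rim 3}, {rim 3, hub}}"
  let ?C = "{{hub, rim 4}, {rim 4, rim 0}, {rim 0, hub}}"
  have "is_cycle chorded_wheel ?A" "is_cycle chorded_wheel ?B" "is_cycle chorded_wheel ?C"
    by (intro is_cycle_triangle; simp add: edges_chorded_wheel doubleton_eq_iff)+
  then show "\<forall>C\<in>{?A, ?B, ?C}. is_triangle chorded_wheel C"
    by (simp add: is_triangle_def doubleton_eq_iff)
  have "?A \<inter> ?B = {}" "?A \<inter> ?C = {}" "?B \<inter> ?C = {}" by (simp_all add: doubleton_eq_iff)
  then show "disjoint {?A, ?B, ?C}" "card {?A, ?B, ?C} = 3"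
    by (intro disjoint_triple; simp)+
qed

text \<open>
  Three disjoint negative cycles would cover all three negative edges. As their union has even
  degree everywhere, at each of the odd-degree vertices hub, 1 and 3 it misses some edge, which
  is then a positive one; no positive edge joins two of these vertices, so at most 8 of the
  11 edges would be covered, whereas three cycles need 9.
\<close>

lemma card_negative_cycle_packing:
  assumes neg: "\<forall>C\<in>P. is_negative_cycle signed_chorded_wheel C" and disj: "disjoint P"
  shows "card P \<le> 2"
proof (rule ccontr)
  let ?E = "edges chorded_wheel" and ?U = "\<Union> P"
  assume "\<not> card P \<le> 2"
  moreover have cyc: "\<forall>C\<in>P. is_cycle chorded_wheel C"
    using neg by (simp add: is_negative_cycle_def)
  ultimately have P: "card P = 3"
    using card_cycle_packing_chorded_wheel[OF _ disj] by fastforce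
  then have fin: "finite P" by (metis card.infinite zero_neq_numeral)
  have U: "?U \<subseteq> ?E" using cyc unfolding is_cycle_def by blast
  have N: "finite negative_edges" "card negative_edges = 3"
    by (simp_all add: negative_edges_def doubleton_eq_iff)
  \<comment> \<open>The cycles meet \<open>negative_edges\<close> in nonempty disjoint sets; as
    there are three of each, every negative edge is covered.\<close>
  have "card P \<le> (\<Sum>C\<in>P. card (C \<inter> negative_edges))"
  proof -
    have "1 \<le> card (C \<inter> negative_edges)" if "C \<in> P" for C
      using negative_cycle_meets_negative_edges neg that N(1) by (simp add: Suc_le_eq card_gt_0_iff)
    then show ?thesis using sum_mono[of P "\<lambda>_. 1" "\<lambda>C. card (C \<inter> negative_edges)"] by simp
  qed
  also have "\<dots> = card (\<Union>C\<in>P. C \<inter> negative_edges)"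
    using disj fin N(1) by (intro card_UN_disjoint[symmetric]) (auto simp: pairwise_def disjnt_def)
  finally have "card negative_edges \<le> card (?U \<inter> negative_edges)"
    unfolding P N(2) Int_Union2 .
  then have "?U \<inter> negative_edges = negative_edges"
    using N(1) by (intro card_seteq) auto
  then have cover: "negative_edges \<subseteq> ?U" by blast
  \<comment> \<open>If all positive edges at \<open>v\<close> were covered, then by
    \<open>cover\<close> all edges at \<open>v\<close> would be, and the union would have odd degree
    there.\<close>
  have missed: "\<exists>e \<in> {e \<in> ?E. v \<in> e} - negative_edges. e \<notin> ?U"
    if "odd (degree chorded_wheel v)" for v
  proof (rule ccontr)
    assume "\<not> ?thesis"
    then have "{e \<in> ?E. v \<in> e} = {e \<in> ?U. v \<in> e}" using U cover by blast
    then show False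
      using that cycle_packing_even_degree[OF cyc disj fin, of v] by (simp add: degree_def)
  qed
  have "odd (degree chorded_wheel hub)" "odd (degree chorded_wheel (rim 1))"
    "odd (degree chorded_wheel (rim 3))"
    unfolding degree_chorded_wheel by simp_all
  from this[THEN missed] obtain a b c
    where a: "a \<in> {e \<in> ?E. hub \<in> e} - negative_edges" "a \<notin> ?U"
      and b: "b \<in> {e \<in> ?E. rim 1 \<in> e} - negative_edges" "b \<notin> ?U"
      and c: "c \<in> {e \<in> ?E. rim 3 \<in> e} - negative_edges" "c \<notin> ?U"
    by (elim bexE) (rule that)
  have "{{hub, rim 0}, {hub, rim 2}, {hub, rim 4}} \<inter> {{rim 0, rim 1}, {rim 1, rim 2}} = {}"
    "{{hub, rim 0}, {hub, rim 2}, {hub, rim 4}} \<inter> {{rim 2, rim 3}, {rim 3, rim 4}} = {}"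
    "{{rim 0, rim 1}, {rim 1, rim 2}} \<inter> {{rim 2, rim 3}, {rim 3, rim 4}} = {}"
    by (simp_all add: doubleton_eq_iff)
  then have "a \<noteq> b" "a \<noteq> c" "b \<noteq> c"
    using a(1) b(1) c(1) unfolding positive_incident_chorded_wheel by (metis disjoint_iff)+
  then have "card {a, b, c} = 3" by simp
  moreover have "card (?U \<union> {a, b, c}) \<le> card ?E"
    using U a(1) b(1) c(1) by (intro card_mono finite_edges_chorded_wheel) simp
  moreover have "card (?U \<union> {a, b, c}) = card ?U + card {a, b, c}"
    using finite_subset[OF U finite_edges_chorded_wheel] a(2) b(2) c(2)
    by (intro card_Un_disjoint) simp_all
  ultimately have "card ?U \<le> 8" using card_edges_chorded_wheel by simp
  then show False using card_cycle_packing_le[OF cyc disj] P by simp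
qed

lemma neg_cycle_packing_signed_chorded_wheel: "neg_cycle_packing signed_chorded_wheel = 2"
  unfolding neg_cycle_packing_def
proof (rule packing_number_eqI)
  \<comment> \<open>The negative faces with indices 1 and 3 share only the hub.\<close>
  let ?A = "{{hub, rim 1}, {rim 1, rim 2}, {rim 2, hub}}"
  let ?B = "{{hub, rim 3}, {rim 3, rim 4}, {rim 4, hub}}"
  show "\<forall>C\<in>{?A, ?B}. is_negative_cycle signed_chorded_wheel C"
    using negative_face_negative[of 1] negative_face_negative[of 3] by (simp add: negative_face_def)
  have "?A \<inter> ?B = {}" by (simp add: doubleton_eq_iff)
  then show "disjoint {?A, ?B}" "card {?A, ?B} = 2"
    by (intro disjoint_pair; simp)+
qed (rule card_negative_cycle_packing)

lemma triangle_packing_signed_chorded_wheel: "triangle_packing signed_chorded_wheel = 3"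
proof -
  obtain P where "\<forall>C\<in>P. is_triangle chorded_wheel C" "disjoint P" "card P = 3"
    by (rule triangle_packing_chorded_wheel)
  then show ?thesis unfolding triangle_packing_def
    by (intro packing_number_eqI[where P = P])
      (auto simp: is_triangle_def intro: card_cycle_packing_chorded_wheel)
qed

lemma cycle_packing_signed_chorded_wheel: "cycle_packing signed_chorded_wheel = 3"
proof -
  obtain P where "\<forall>C\<in>P. is_triangle chorded_wheel C" "disjoint P" "card P = 3"
    by (rule triangle_packing_chorded_wheel)
  then show ?thesis unfolding cycle_packing_def
    by (intro packing_number_eqI[where P = P])
      (auto simp: is_triangle_def intro: card_cycle_packing_chorded_wheel)
qed

theorem mainTheorem13:
  shows "(\<exists>\<Sigma> :: (nat + nat) signed_graph.
            wf_signed_graph \<Sigma> \<and>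
            planar (underlying \<Sigma>) \<and>
            k_connected 2 (underlying \<Sigma>) \<and>
            min_degree (underlying \<Sigma>) = 3 \<and>
            (\<exists>x\<in>verts (wheel 5). \<exists>y\<in>verts (wheel 5).
               x \<noteq> y \<and> {x, y} \<notin> edges (wheel 5) \<and>
               underlying \<Sigma> = add_edge (wheel 5) x y) \<and>
            frustration_index \<Sigma> = 3 \<and>
            neg_cycle_packing \<Sigma> = 2 \<and>
            triangle_packing \<Sigma> = 3 \<and>
            cycle_packing \<Sigma> = 3 \<and>
            neg_cycle_packing \<Sigma> < min (frustration_index \<Sigma>) (triangle_packing \<Sigma>)) \<and>
         \<not> (\<forall>\<Sigma> :: (nat + nat) signed_graph. wf_signed_graph \<Sigma> \<longrightarrow>
              neg_cycle_packing \<Sigma> = min (frustration_index \<Sigma>) (cycle_packing \<Sigma>)) \<and>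
         \<not> (\<forall>\<Sigma> :: (nat + nat) signed_graph.
              wf_signed_graph \<Sigma> \<and> planar (underlying \<Sigma>) \<longrightarrow>
              neg_cycle_packing \<Sigma> = min (frustration_index \<Sigma>) (cycle_packing \<Sigma>))"
proof -
  let ?S = signed_chorded_wheel
  note invariants = frustration_index_signed_chorded_wheel neg_cycle_packing_signed_chorded_wheel
    triangle_packing_signed_chorded_wheel cycle_packing_signed_chorded_wheel
  have wf: "wf_signed_graph ?S"
    using simple_chorded_wheel by (simp add: wf_signed_graph_def fin_simple_graph_def)
  have pl: "planar (underlying ?S)" by (simp add: planar_chorded_wheel)
  have chord: "\<exists>x\<in>verts (wheel 5). \<exists>y\<in>verts (wheel 5).
      x \<noteq> y \<and> {x, y} \<notin> edges (wheel 5) \<and> underlying ?S = add_edge (wheel 5) x y"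
    by (intro bexI[of _ "rim 0"] bexI[of _ "rim 2"])
      (simp_all add: chorded_wheel_def verts_wheel_5 edges_wheel_5 doubleton_eq_iff)
  \<comment> \<open>The values are 2 and 3. As \<open>?S\<close> is planar, it refutes both
    universal statements.\<close>
  have neq: "neg_cycle_packing ?S \<noteq> min (frustration_index ?S) (cycle_packing ?S)"
    by (simp add: invariants)
  show ?thesis
  proof (intro conjI)
    show "\<exists>\<Sigma> :: (nat + nat) signed_graph. wf_signed_graph \<Sigma> \<and> planar (underlying \<Sigma>) \<and>
        k_connected 2 (underlying \<Sigma>) \<and> min_degree (underlying \<Sigma>) = 3 \<and>
        (\<exists>x\<in>verts (wheel 5). \<exists>y\<in>verts (wheel 5).
           x \<noteq> y \<and> {x, y} \<notin> edges (wheel 5) \<and> underlying \<Sigma> = add_edge (wheel 5) x y) \<and>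
        frustration_index \<Sigma> = 3 \<and> neg_cycle_packing \<Sigma> = 2 \<and>
        triangle_packing \<Sigma> = 3 \<and> cycle_packing \<Sigma> = 3 \<and>
        neg_cycle_packing \<Sigma> < min (frustration_index \<Sigma>) (triangle_packing \<Sigma>)"
      using wf pl chord
      by (intro exI[of _ ?S])
        (simp add: invariants two_connected_chorded_wheel min_degree_chorded_wheel)
  qed (use wf pl neq in blast)+
qed

end
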